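(* Let $A$, $B$ and $C$ be positive definite $n\times n$ complex matrices such that $C\ge A+B$. Then for all $j=1,2,\dots,n$, $$s_j\big(C+A^{\frac12}B^{\frac12}+B^{\frac12}A^{\frac12}\big)\le s_j\big(C+A\sharp B+A\natural\natural B\big).$$
   Context: For Hermitian matrices, $C\ge D$ means $C-D$ is positive semi-definite. $s_1(X)\ge\dots\ge s_n(X)$ denote the singular values of an $n\times n$ matrix $X$. For positive definite $A,B$, the geometric mean is $A\sharp B=A^{\frac12}(A^{-\frac12}BA^{-\frac12})^{\frac12}A^{\frac12}$, and $A\natural\natural B=A^{\frac12}(B^{\frac12}A^{-1}B^{\frac12})^{\frac12}A^{\frac12}$. *)

theory Defs
  imports
    "Jordan_Normal_Form.Schur_Decomposition"
    "Jordan_Normal_Form.Gauss_Jordan_Elimination"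
    "Jordan_Normal_Form.Char_Poly"
    "HOL-Computational_Algebra.Fundamental_Theorem_Algebra"
begin

definition hermitian_mat :: "complex mat \<Rightarrow> bool" where
  "hermitian_mat A \<longleftrightarrow> mat_adjoint A = A"

(* (A *\<^sub>v v) \<bullet>c v is the quadratic form v* A v. Positivity refers to the order of
   HOL-Library.Complex_Order: 0 \<le> z (0 < z) says that z is real and non-negative (positive). *)

definition pos_semidef :: "complex mat \<Rightarrow> bool" where
  "pos_semidef A \<longleftrightarrow>
     hermitian_mat A \<and> (\<forall>v \<in> carrier_vec (dim_row A). 0 \<le> (A *\<^sub>v v) \<bullet>c v)"

definition pos_def :: "complex mat \<Rightarrow> bool" where
  "pos_def A \<longleftrightarrow>
     hermitian_mat A \<and>
     (\<forall>v \<in> carrier_vec (dim_row A). v \<noteq> 0\<^sub>v (dim_row A) \<longrightarrow> 0 < (A *\<^sub>v v) \<bullet>c v)"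

definition loewner_ge :: "complex mat \<Rightarrow> complex mat \<Rightarrow> bool" (infix \<open>\<ge>\<^sub>L\<close> 50) where
  "C \<ge>\<^sub>L D \<longleftrightarrow> pos_semidef (C - D)"

(* The power 1/2: the unique positive semi-definite square root.
   Unspecified unless A is positive semi-definite. *)

definition mat_sqrt :: "complex mat \<Rightarrow> complex mat" where
  "mat_sqrt A = (THE X. pos_semidef X \<and> X * X = A)"

(* Unspecified unless A is invertible. *)

definition mat_inv :: "complex mat \<Rightarrow> complex mat" where
  "mat_inv A = the (mat_inverse A)"

definition geometric_mean :: "complex mat \<Rightarrow> complex mat \<Rightarrow> complex mat" (infixl \<open>\<sharp>\<close> 70) where
  "A \<sharp> B =
     mat_sqrt A * mat_sqrt (mat_inv (mat_sqrt A) * B * mat_inv (mat_sqrt A)) * mat_sqrt A"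

definition natural_mean :: "complex mat \<Rightarrow> complex mat \<Rightarrow> complex mat"
    (infixl \<open>\<natural>\<natural>\<close> 70) where
  "A \<natural>\<natural> B =
     mat_sqrt A * mat_sqrt (mat_sqrt B * mat_inv A * mat_sqrt B) * mat_sqrt A"

(* The square roots of the eigenvalues of X* X, repeated according to their multiplicity as roots
   of the characteristic polynomial, in decreasing order. These eigenvalues are real and
   non-negative, so Re loses nothing. *)

definition singular_values :: "complex mat \<Rightarrow> real list" where
  "singular_values X =
     rev (sorted_list_of_multiset
       (image_mset (\<lambda>e. sqrt (Re e)) (proots (char_poly (mat_adjoint X * X)))))"

(* The index j starts at 1: for an n \<times> n matrix X,
   singular_value 1 X \<ge> ... \<ge> singular_value n X. *)

definition singular_value :: "nat \<Rightarrow> complex mat \<Rightarrow> real" where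
  "singular_value j X = singular_values X ! (j - 1)"

end

theory Submission
  imports Defs
begin

text \<open>Write \<open>P = A^(1/2)\<close> and \<open>Q = B^(1/2)\<close>. The inequality for singular values comes from an inequality
  in the Loewner order, namely \<open>P * Q + Q * P \<le> A \<sharp> B + A \<natural>\<natural> B\<close>.

  Put \<open>R = (Q * A^(-1) * Q)^(1/2)\<close>. Then \<open>A \<natural>\<natural> B = P * R * P\<close> by definition, and the polar
  decomposition of \<open>P^(-1) * Q\<close> shows that \<open>A \<sharp> B = Q * R^(-1) * Q\<close> (lemma \<open>means_eq\<close>). With
  \<open>F = P - Q * R^(-1)\<close>, expanding \<open>F * R * F^*\<close> gives
  \<open>P * R * P + Q * R^(-1) * Q - P * Q - Q * P\<close> (lemma \<open>cross_terms_identity\<close>), and this is positive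
  semi-definite because \<open>R\<close> is.

  Let \<open>H = C + P * Q + Q * P\<close> and \<open>K = C + A \<sharp> B + A \<natural>\<natural> B\<close>. Since \<open>C \<ge> P^2 + Q^2\<close>, the matrix
  \<open>H = (C - A - B) + (P + Q)^2\<close> is positive semi-definite, and so is \<open>K\<close>, which exceeds it. Hence the
  singular values of both are their eigenvalues (lemma \<open>singular_value_pos_semidef\<close>), and ordered
  eigenvalues increase with the matrix (lemma \<open>spectral_decomp_mono\<close>).

  All of this rests on the spectral theorem for Hermitian matrices (lemma \<open>spectral_decomp_exists\<close>),
  which also yields existence and uniqueness of the positive semi-definite square root.\<close>

section \<open>The adjoint of a complex matrix\<close>

lemma mat_adjoint_dim [simp]:
  "dim_row (mat_adjoint A) = dim_col A" "dim_col (mat_adjoint A) = dim_row A"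
  by (auto simp: mat_adjoint_def mat_of_rows_def)

text \<open>Stated as an equivalence so that the simplifier reduces a carrier condition on the adjoint to one on
  the matrix even when the dimensions are still schematic.\<close>

lemma mat_adjoint_carrier [simp]: "mat_adjoint A \<in> carrier_mat m n \<longleftrightarrow> A \<in> carrier_mat n m"
  unfolding carrier_mat_def by (simp add: conj_commute)

lemma mat_adjoint_index [simp]:
  assumes "i < dim_col A" "j < dim_row A"
  shows "mat_adjoint A $$ (i, j) = conjugate (A $$ (j, i))"
  using assms by (simp add: mat_adjoint_def mat_of_rows_def)

lemma mat_adjoint_adjoint [simp]: "mat_adjoint (mat_adjoint A) = (A :: complex mat)"
  by (rule eq_matI) auto

lemma mat_adjoint_one [simp]: "mat_adjoint (1\<^sub>m n :: complex mat) = 1\<^sub>m n"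
  by (rule eq_matI) auto

lemma mat_adjoint_add:
  assumes "A \<in> carrier_mat n m" "B \<in> carrier_mat n m"
  shows "mat_adjoint (A + B :: complex mat) = mat_adjoint A + mat_adjoint B"
  using assms by (intro eq_matI) auto

lemma mat_adjoint_minus:
  assumes "A \<in> carrier_mat n m" "B \<in> carrier_mat n m"
  shows "mat_adjoint (A - B :: complex mat) = mat_adjoint A - mat_adjoint B"
  using assms by (intro eq_matI) auto

lemma mat_adjoint_mult:
  assumes "A \<in> carrier_mat n m" "B \<in> carrier_mat m k"
  shows "mat_adjoint (A * B :: complex mat) = mat_adjoint B * mat_adjoint A"
  using assms by (intro eq_matI) (auto simp: scalar_prod_def sum_conjugate mult.commute)

lemma cscalar_prod_mat_adjoint:
  fixes A :: "complex mat"
  assumes "A \<in> carrier_mat n m" "v \<in> carrier_vec m" "w \<in> carrier_vec n"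
  shows "(A *\<^sub>v v) \<bullet>c w = v \<bullet>c (mat_adjoint A *\<^sub>v w)"
proof -
  have "(A *\<^sub>v v) \<bullet>c w = (\<Sum>i<n. \<Sum>j<m. A $$ (i, j) * v $ j * cnj (w $ i))"
    using assms by (auto simp: scalar_prod_def sum_distrib_right lessThan_atLeast0 intro!: sum.cong)
  also have "\<dots> = (\<Sum>j<m. \<Sum>i<n. A $$ (i, j) * v $ j * cnj (w $ i))"
    by (rule sum.swap)
  also have "\<dots> = v \<bullet>c (mat_adjoint A *\<^sub>v w)"
    using assms by (auto simp: scalar_prod_def sum_distrib_left lessThan_atLeast0 mult_ac intro!: sum.cong)
  finally show ?thesis .
qed

lemma cscalar_prod_self:
  fixes v :: "complex vec"
  shows "v \<bullet>c v = complex_of_real (\<Sum>i<dim_vec v. (cmod (v $ i))\<^sup>2)"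
  by (simp add: scalar_prod_def lessThan_atLeast0 complex_norm_square of_real_sum
      del: of_real_power)

section \<open>Unitary diagonalisation of Hermitian matrices\<close>

definition unitary_mat :: "nat \<Rightarrow> complex mat \<Rightarrow> bool" where
  "unitary_mat n U \<longleftrightarrow>
     U \<in> carrier_mat n n \<and> mat_adjoint U * U = 1\<^sub>m n \<and> U * mat_adjoint U = 1\<^sub>m n"

definition diagonal :: "nat \<Rightarrow> (nat \<Rightarrow> complex) \<Rightarrow> complex mat" where
  "diagonal n d = mat n n (\<lambda>(i, j). if i = j then d i else 0)"

lemma diagonal_carrier [simp]: "diagonal n d \<in> carrier_mat n n"
  by (simp add: diagonal_def)

lemma unitary_matI:
  assumes "U \<in> carrier_mat n n" "mat_adjoint U * U = 1\<^sub>m n"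
  shows "unitary_mat n U"
  using assms mat_mult_left_right_inverse[of "mat_adjoint U" n U]
  by (simp add: unitary_mat_def)

lemma unitary_mat_mult:
  assumes "unitary_mat n U" "unitary_mat n V"
  shows "unitary_mat n (U * V)"
proof (rule unitary_matI)
  have c: "U \<in> carrier_mat n n" "V \<in> carrier_mat n n"
    using assms by (auto simp: unitary_mat_def)
  then show "U * V \<in> carrier_mat n n" by simp
  have "mat_adjoint (U * V) * (U * V) = mat_adjoint V * (mat_adjoint U * (U * V))"
    using c by (simp add: mat_adjoint_mult[OF c] assoc_mult_mat[of _ n n _ n _ n])
  also have "mat_adjoint U * (U * V) = (mat_adjoint U * U) * V"
    using c by (simp add: assoc_mult_mat[of _ n n _ n _ n])
  also have "\<dots> = V" using assms c by (simp add: unitary_mat_def)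
  finally show "mat_adjoint (U * V) * (U * V) = 1\<^sub>m n" using assms by (simp add: unitary_mat_def)
qed

text \<open>The deflation step of the spectral theorem: complete the vector to a basis, orthogonalise it by
  Gram-Schmidt, which does not change the first vector, and normalise.\<close>

lemma unitary_mat_with_first_col:
  assumes v: "v \<in> carrier_vec n" and v0: "v \<noteq> 0\<^sub>v n"
  obtains U c where "unitary_mat n U" "col U 0 = c \<cdot>\<^sub>v v"
proof -
  interpret cof_vec_space n "TYPE(complex)" .
  define b where "b = basis_completion v"
  define ws where "ws = gram_schmidt n b"
  have n: "n \<noteq> 0" using v v0 by (cases n) auto
  from basis_completion[OF v v0, folded b_def]
  have dist_b: "distinct b" and indep: "\<not> lin_dep (set b)" and b: "set b \<subseteq> carrier_vec n"
    and hdb: "hd b = v" and len_b: "length b = n" by auto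
  from hdb len_b n obtain vs where bv: "b = v # vs" by (cases b) auto
  from gram_schmidt_result[OF b dist_b indep refl, folded ws_def]
  have ws: "set ws \<subseteq> carrier_vec n" "corthogonal ws" "length ws = n"
    by (auto simp: len_b)
  from gram_schmidt_hd[OF v, of vs, folded bv] have hdws: "hd ws = v" unfolding ws_def .
  have ws0: "ws ! 0 = v" using hdws ws n by (cases ws) auto
  define c where "c w = complex_of_real (1 / sqrt (Re (w \<bullet>c w)))" for w :: "complex vec"
  have cnj_c: "cnj (c w) = c w" for w by (simp add: c_def)
  define U where "U = mat_of_cols n (map (\<lambda>w. c w \<cdot>\<^sub>v w) ws)"
  have U: "U \<in> carrier_mat n n" using ws by (auto simp: U_def)
  have wsc: "ws ! i \<in> carrier_vec n" if "i < n" for i using that ws by auto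
  have col: "col U i = c (ws ! i) \<cdot>\<^sub>v (ws ! i)" if "i < n" for i
    using that ws wsc[OF that] by (simp add: U_def col_mat_of_cols)
  have "mat_adjoint U * U = 1\<^sub>m n"
  proof (rule eq_matI)
    fix i j assume "i < dim_row (1\<^sub>m n :: complex mat)" "j < dim_col (1\<^sub>m n :: complex mat)"
    then have ij: "i < n" "j < n" by auto
    have "(mat_adjoint U * U) $$ (i, j) = col U j \<bullet>c col U i"
      using U ij by (auto simp: scalar_prod_def mult.commute intro!: sum.cong)
    also have "\<dots> = c (ws ! i) * c (ws ! j) * (ws ! j \<bullet>c ws ! i)"
      using wsc[OF ij(1)] wsc[OF ij(2)] by (simp add: col ij conjugate_smult_vec cnj_c
          smult_scalar_prod_distrib[of _ n] scalar_prod_smult_distrib[of _ n])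
    also have "\<dots> = (if i = j then 1 else 0)"
    proof (cases "i = j")
      case True
      have nz: "ws ! i \<bullet>c ws ! i \<noteq> 0"
        using ws(2,3) ij by (auto simp: corthogonal_def)
      define r where "r = (\<Sum>k<dim_vec (ws ! i). (cmod (ws ! i $ k))\<^sup>2)"
      have r: "ws ! i \<bullet>c ws ! i = complex_of_real r" by (simp add: cscalar_prod_self r_def)
      have "r \<noteq> 0" using nz unfolding r by simp
      moreover have "r \<ge> 0" unfolding r_def by (intro sum_nonneg) simp
      ultimately have "r > 0" by simp
      then have "complex_of_real (1 / sqrt r) * complex_of_real (1 / sqrt r) * complex_of_real r = 1"
        by (simp add: field_simps flip: of_real_mult)
      with \<open>r > 0\<close> show ?thesis unfolding True[symmetric] c_def r by simp
    next
      case False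
      then show ?thesis using ws(2,3) ij by (auto simp: corthogonal_def)
    qed
    finally show "(mat_adjoint U * U) $$ (i, j) = 1\<^sub>m n $$ (i, j)" using ij by simp
  qed (use U in auto)
  then have "unitary_mat n U" using U by (rule unitary_matI[rotated])
  moreover have "col U 0 = c v \<cdot>\<^sub>v v" using col[of 0] n ws0 by simp
  ultimately show ?thesis using that by blast
qed

lemma unitary_matD:
  assumes "unitary_mat n U"
  shows "U \<in> carrier_mat n n" "mat_adjoint U * U = 1\<^sub>m n" "U * mat_adjoint U = 1\<^sub>m n"
    "mat_adjoint U \<in> carrier_mat n n"
  using assms by (auto simp: unitary_mat_def)

text \<open>Both bracketings of the change of basis occur below. \<open>U\<close> and \<open>V\<close> are kept abstract because
  the simplifier then reassociates products without having to find the dimensions of an adjoint.\<close>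

lemma conjugate_by_inverses_cancel:
  fixes X :: "'a :: comm_ring_1 mat"
  assumes c: "U \<in> carrier_mat n n" "V \<in> carrier_mat n n" "X \<in> carrier_mat n n"
    and inv: "U * V = 1\<^sub>m n"
  shows "U * (V * (X * U)) * V = X"
proof -
  have "U * (V * (X * U)) * V = (U * V) * X * (U * V)"
    using c by (simp add: assoc_mult_mat[of _ n n _ n _ n])
  then show ?thesis using c by (simp add: inv)
qed

lemma conjugate_by_inverses_cancel_left:
  fixes X :: "'a :: comm_ring_1 mat"
  assumes c: "U \<in> carrier_mat n n" "V \<in> carrier_mat n n" "X \<in> carrier_mat n n"
    and inv: "V * U = 1\<^sub>m n"
  shows "V * (U * X * V * U) = X"
proof -
  have "V * (U * X * V * U) = (V * U) * X * (V * U)"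
    using c by (simp add: assoc_mult_mat[of _ n n _ n _ n])
  then show ?thesis using c by (simp add: inv)
qed

lemma four_block_diag_mult:
  fixes A B A' B' :: "'a :: comm_ring_1 mat"
  assumes "A \<in> carrier_mat n n" "A' \<in> carrier_mat n n" "B \<in> carrier_mat m m" "B' \<in> carrier_mat m m"
  shows "four_block_mat A (0\<^sub>m n m) (0\<^sub>m m n) B * four_block_mat A' (0\<^sub>m n m) (0\<^sub>m m n) B'
    = four_block_mat (A * A') (0\<^sub>m n m) (0\<^sub>m m n) (B * B')"
  using assms by (subst mult_four_block_mat[of _ n n _ m _ m _ _ n _ m]) auto

text \<open>The spectral theorem by deflation. In an orthonormal basis whose first vector is an eigenvector,
  the first column of a Hermitian matrix is a multiple of the first unit vector, and so is the first
  row by symmetry; what remains is a Hermitian matrix of smaller size. The diagonal follows the given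
  factorisation of the characteristic polynomial, so that the order of the eigenvalues can be
  chosen freely.\<close>

lemma hermitian_unitary_diagonal:
  assumes "A \<in> carrier_mat n n" "hermitian_mat A" "char_poly A = (\<Prod>e\<leftarrow>es. [:- e, 1:])"
  shows "\<exists>U. unitary_mat n U \<and> A = U * diagonal n (\<lambda>i. es ! i) * mat_adjoint U"
  using assms
proof (induction es arbitrary: n A)
  case Nil
  then have "n = 0" using degree_monic_char_poly[of A n] by auto
  with Nil show ?case by (intro exI[of _ "1\<^sub>m 0"]) (auto simp: unitary_mat_def)
next
  case (Cons e es)
  note A = Cons.prems(1) and herm = Cons.prems(2) and cp = Cons.prems(3)
  have "n \<noteq> 0"
  proof
    assume "n = 0"
    then have "degree (char_poly A) = 0" using degree_monic_char_poly[OF A] by simp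
    moreover have "monic (\<Prod>e\<leftarrow>es. [:- e, 1:])" by (rule monic_prod_list) auto
    ultimately show False unfolding cp list.map prod_list.Cons by (subst (asm) degree_mult_eq) auto
  qed
  then obtain m where n: "n = Suc m" by (cases n) auto
  have "eigenvalue A e" unfolding eigenvalue_root_char_poly[OF A] cp by simp
  then obtain v where v: "v \<in> carrier_vec n" "v \<noteq> 0\<^sub>v n" "A *\<^sub>v v = e \<cdot>\<^sub>v v"
    using A by (auto simp: eigenvalue_def eigenvector_def)
  obtain U c where unitary: "unitary_mat n U" and col0: "col U 0 = c \<cdot>\<^sub>v v"
    using unitary_mat_with_first_col[OF v(1,2)] .
  note U = unitary_matD[OF unitary]
  define A' where "A' = mat_adjoint U * (A * U)"
  have A': "A' \<in> carrier_mat n n" using U A by (simp add: A'_def)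
  have A_eq: "A = U * A' * mat_adjoint U"
    using conjugate_by_inverses_cancel[of U n "mat_adjoint U" A] U A by (simp add: A'_def)
  have herm': "mat_adjoint A' = A'"
    using U A herm
    by (simp add: A'_def hermitian_mat_def mat_adjoint_mult[of _ n n _ n] assoc_mult_mat[of _ n n _ n _ n])
  have A'_i0: "A' $$ (i, 0) = (if i = 0 then e else 0)" if "i < n" for i
  proof -
    have "col (A * U) 0 = e \<cdot>\<^sub>v col U 0"
      using col_mult2[OF A U(1), of 0] v n A
      by (simp add: col0 mult_mat_vec[of A n n] smult_smult_assoc mult.commute)
    then have "A' $$ (i, 0) = e * (row (mat_adjoint U) i \<bullet> col U 0)"
      using A U(1) n that by (simp add: A'_def)
    also have "row (mat_adjoint U) i \<bullet> col U 0 = (mat_adjoint U * U) $$ (i, 0)"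
      using U(1) n that by simp
    finally show ?thesis unfolding U(2) using that n by simp
  qed
  have A'_0i: "A' $$ (0, i) = (if i = 0 then e else 0)" if "i < n" for i
  proof -
    have "A' $$ (0, i) = cnj (A' $$ (i, 0))"
      using mat_adjoint_index[of 0 A' i] herm' A' n that by simp
    moreover have "A' $$ (0, 0) = cnj (A' $$ (0, 0))"
      using mat_adjoint_index[of 0 A' 0] herm' A' n that by simp
    ultimately show ?thesis using A'_i0[OF that] A'_i0[of 0] n by auto
  qed
  define A3 where "A3 = mat m m (\<lambda>(i, j). A' $$ (Suc i, Suc j))"
  have A3: "A3 \<in> carrier_mat m m" by (simp add: A3_def)
  define E where "E = mat 1 1 (\<lambda>_. e)"
  have E: "E \<in> carrier_mat 1 1" by (simp add: E_def)
  have A'_block: "A' = four_block_mat E (0\<^sub>m 1 m) (0\<^sub>m m 1) A3"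
  proof (rule eq_matI)
    fix i j
    assume "i < dim_row (four_block_mat E (0\<^sub>m 1 m) (0\<^sub>m m 1) A3)"
      "j < dim_col (four_block_mat E (0\<^sub>m 1 m) (0\<^sub>m m 1) A3)"
    then have "i < Suc m" "j < Suc m" using E A3 by auto
    then show "A' $$ (i, j) = four_block_mat E (0\<^sub>m 1 m) (0\<^sub>m m 1) A3 $$ (i, j)"
      using A'_0i[of j] A'_i0[of i] E A3 n by (cases i; cases j) (auto simp: A3_def E_def)
  qed (use A' E A3 n in auto)
  have "hermitian_mat A3" unfolding hermitian_mat_def
  proof (rule eq_matI)
    fix i j assume "i < dim_row A3" "j < dim_col A3"
    then show "mat_adjoint A3 $$ (i, j) = A3 $$ (i, j)"
      using mat_adjoint_index[of "Suc i" A' "Suc j"] herm' A' n by (simp add: A3_def)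
  qed (use A3 in auto)
  moreover have "char_poly A3 = (\<Prod>e\<leftarrow>es. [:- e, 1:])"
  proof -
    have "similar_mat A A'"
      using similar_mat_witI[OF U(3,2) A_eq A A' U(1,4)] by (auto simp: similar_mat_def)
    then have "char_poly A = char_poly E * char_poly A3"
      using char_poly_four_block_zeros_col[OF E zero_carrier_mat A3, of]
      by (simp add: char_poly_similar A'_block)
    moreover have "char_poly E = [:- e, 1:]"
      by (simp add: E_def char_poly_defs det_def sign_def)
    ultimately show ?thesis
      unfolding cp by (metis (no_types, lifting) list.simps(9) mult_cancel_left pCons_eq_0_iff
          prod_list.Cons zero_neq_one)
  qed
  ultimately obtain V where unitaryV: "unitary_mat m V"
    and A3_eq: "A3 = V * diagonal m (\<lambda>i. es ! i) * mat_adjoint V"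
    using Cons.IH[OF A3] by blast
  note V = unitary_matD[OF unitaryV]
  define W where "W = four_block_mat (1\<^sub>m 1) (0\<^sub>m 1 m) (0\<^sub>m m 1) V"
  have W: "W \<in> carrier_mat n n"
    using four_block_carrier_mat[of "1\<^sub>m 1" 1 1 V m m] V(1) by (simp add: W_def n)
  have W_adj: "mat_adjoint W = four_block_mat (1\<^sub>m 1) (0\<^sub>m 1 m) (0\<^sub>m m 1) (mat_adjoint V)"
    using V by (intro eq_matI) (auto simp: W_def)
  have "mat_adjoint W * W = four_block_mat (1\<^sub>m 1) (0\<^sub>m 1 m) (0\<^sub>m m 1) (1\<^sub>m m)"
    unfolding W_adj unfolding W_def using four_block_diag_mult[of "1\<^sub>m 1" 1 "1\<^sub>m 1" _ m V] V
    by simp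
  also have "\<dots> = 1\<^sub>m n" by (simp add: n)
  finally have unitaryW: "unitary_mat n W" using W by (intro unitary_matI)
  have D: "diagonal n (\<lambda>i. (e # es) ! i)
      = four_block_mat E (0\<^sub>m 1 m) (0\<^sub>m m 1) (diagonal m (\<lambda>i. es ! i))"
    by (intro eq_matI) (auto simp: diagonal_def E_def n less_Suc_eq_0_disj)
  have "W * diagonal n (\<lambda>i. (e # es) ! i) * mat_adjoint W = A'"
    unfolding W_adj D A'_block A3_eq unfolding W_def
    using V(1,4) E diagonal_carrier[of m "\<lambda>i. es ! i"]
      four_block_diag_mult[of "1\<^sub>m 1" 1 E V m "diagonal m (\<lambda>i. es ! i)"]
      four_block_diag_mult[of E 1 "1\<^sub>m 1" "V * diagonal m (\<lambda>i. es ! i)" m "mat_adjoint V"]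
    by simp
  moreover have "U * W * X * mat_adjoint (U * W) = U * (W * X * mat_adjoint W) * mat_adjoint U"
    if "X \<in> carrier_mat n n" for X
    using U W that by (simp add: mat_adjoint_mult[of _ n n _ n] assoc_mult_mat[of _ n n _ n _ n])
  ultimately have "A = U * W * diagonal n (\<lambda>i. (e # es) ! i) * mat_adjoint (U * W)"
    using A_eq by simp
  then show ?case using unitary_mat_mult[OF unitary unitaryW] by blast
qed

text \<open>The columns of \<open>U\<close> are an orthonormal eigenbasis, and \<open>d\<close> lists the eigenvalues from the
  largest to the smallest.\<close>

definition spectral_decomp :: "nat \<Rightarrow> complex mat \<Rightarrow> complex mat \<Rightarrow> (nat \<Rightarrow> real) \<Rightarrow> bool" where
  "spectral_decomp n A U d \<longleftrightarrow>
     unitary_mat n U \<and> A = U * diagonal n (\<lambda>i. complex_of_real (d i)) * mat_adjoint U \<and>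
     (\<forall>i j. i \<le> j \<longrightarrow> j < n \<longrightarrow> d j \<le> d i)"

text \<open>The eigenvalues are real because the diagonal matrix is unitarily similar to a Hermitian matrix,
  hence Hermitian itself; so sorting by the real part sorts the eigenvalues.\<close>

lemma spectral_decomp_exists:
  assumes A: "A \<in> carrier_mat n n" and herm: "hermitian_mat A"
  obtains U d where "spectral_decomp n A U d"
proof -
  obtain es where es: "char_poly A = (\<Prod>e\<leftarrow>es. [:- e, 1:])" "length es = n"
    using char_poly_factorized[OF A] by blast
  define fs where "fs = rev (sort_key Re es)"
  have len: "length fs = n" by (simp add: fs_def es)
  have "mset (map (\<lambda>e. [:- e, 1:]) fs) = mset (map (\<lambda>e. [:- e, 1:]) es)"
    by (simp add: fs_def)
  then have "char_poly A = (\<Prod>e\<leftarrow>fs. [:- e, 1:])"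
    unfolding es(1) by (metis prod_mset_prod_list)
  from hermitian_unitary_diagonal[OF A herm this]
  obtain U where unitary: "unitary_mat n U" and A_eq: "A = U * diagonal n (\<lambda>i. fs ! i) * mat_adjoint U"
    by blast
  note U = unitary_matD[OF unitary]
  define D where "D = diagonal n (\<lambda>i. fs ! i)"
  have D: "D \<in> carrier_mat n n" by (simp add: D_def)
  have D_eq: "D = mat_adjoint U * (A * U)"
    using conjugate_by_inverses_cancel_left[OF U(1,4) D U(2)] unfolding A_eq D_def by (rule sym)
  have "mat_adjoint D = D"
    using U A herm unfolding D_eq
    by (simp add: hermitian_mat_def mat_adjoint_mult[of _ n n _ n] assoc_mult_mat[of _ n n _ n _ n])
  then have real: "complex_of_real (Re (fs ! i)) = fs ! i" if "i < n" for i
    using mat_adjoint_index[of i D i] that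
    by (simp add: D_def diagonal_def complex_eq_iff)
  have "A = U * diagonal n (\<lambda>i. complex_of_real (Re (fs ! i))) * mat_adjoint U"
  proof -
    have "diagonal n (\<lambda>i. complex_of_real (Re (fs ! i))) = diagonal n (\<lambda>i. fs ! i)"
      by (intro eq_matI) (auto simp: diagonal_def real)
    then show ?thesis using A_eq by simp
  qed
  moreover have "Re (fs ! j) \<le> Re (fs ! i)" if "i \<le> j" "j < n" for i j
  proof -
    have "sorted (map Re (sort_key Re es))" by simp
    then have "sorted_wrt (\<ge>) (map Re fs)"
      by (simp add: fs_def rev_map[symmetric] sorted_wrt_rev)
    then show ?thesis using that len
      by (cases "i = j") (auto simp: sorted_wrt_iff_nth_less)
  qed
  ultimately have "spectral_decomp n A U (\<lambda>i. Re (fs ! i))"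
    using unitary by (simp add: spectral_decomp_def)
  then show ?thesis using that by blast
qed

section \<open>Quadratic forms and positive semi-definite matrices\<close>

lemma diagonal_mult_vec:
  assumes "v \<in> carrier_vec n" "i < n"
  shows "(diagonal n d *\<^sub>v v) $ i = d i * v $ i"
  using assms
  by (simp add: diagonal_def scalar_prod_def if_distrib[of "\<lambda>x. x * _"] cong: if_cong)

lemma diagonal_mult: "diagonal n d * diagonal n e = diagonal n (\<lambda>i. d i * e i)"
proof (rule eq_matI)
  fix i j assume "i < dim_row (diagonal n (\<lambda>i. d i * e i))" "j < dim_col (diagonal n (\<lambda>i. d i * e i))"
  then have ij: "i < n" "j < n" by (auto simp: diagonal_def)
  have "(diagonal n d * diagonal n e) $$ (i, j) = (diagonal n d *\<^sub>v col (diagonal n e) j) $ i"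
    using ij by (simp add: diagonal_def)
  also have "\<dots> = d i * col (diagonal n e) j $ i"
    by (rule diagonal_mult_vec[OF _ ij(1)]) (simp add: diagonal_def carrier_vecI)
  also have "\<dots> = diagonal n (\<lambda>i. d i * e i) $$ (i, j)"
    using ij by (simp add: diagonal_def)
  finally show "(diagonal n d * diagonal n e) $$ (i, j) = diagonal n (\<lambda>i. d i * e i) $$ (i, j)" .
qed (auto simp: diagonal_def)

lemma spectral_decompD:
  assumes "spectral_decomp n A U d"
  shows "U \<in> carrier_mat n n" "A \<in> carrier_mat n n" "mat_adjoint U * U = 1\<^sub>m n"
    "U * mat_adjoint U = 1\<^sub>m n" "mat_adjoint U \<in> carrier_mat n n"
    "A = U * diagonal n (\<lambda>i. complex_of_real (d i)) * mat_adjoint U"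
    "\<And>i j. i \<le> j \<Longrightarrow> j < n \<Longrightarrow> d j \<le> d i"
  using assms unitary_matD[of n U] unfolding spectral_decomp_def
  by (metis diagonal_carrier mult_carrier_mat)+

lemma spectral_decomp_eigenvector:
  assumes A: "spectral_decomp n A U d" and i: "i < n"
  shows "A *\<^sub>v col U i = complex_of_real (d i) \<cdot>\<^sub>v col U i" "col U i \<bullet>c col U i = 1"
proof -
  note U = spectral_decompD[OF A]
  define D where "D = diagonal n (\<lambda>i. complex_of_real (d i))"
  have D: "D \<in> carrier_mat n n" by (simp add: D_def)
  have "A * U = U * D * (mat_adjoint U * U)"
    using U(1,5) D unfolding U(6) D_def[symmetric] by (simp add: assoc_mult_mat[of _ n n _ n _ n])
  then have AU: "A * U = U * D" using U(1,3) D by simp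
  have col_D: "col D i = complex_of_real (d i) \<cdot>\<^sub>v unit_vec n i"
    using i by (intro eq_vecI) (auto simp: D_def diagonal_def)
  have "A *\<^sub>v col U i = col (A * U) i" using col_mult2[OF U(2,1) i] by simp
  also have "\<dots> = U *\<^sub>v col D i" unfolding AU using col_mult2[OF U(1) D i] by simp
  also have "\<dots> = complex_of_real (d i) \<cdot>\<^sub>v (U *\<^sub>v unit_vec n i)"
    unfolding col_D using U(1) i by (simp add: mult_mat_vec[of _ n n])
  also have "U *\<^sub>v unit_vec n i = col U i" using U(1) i by (intro eq_vecI) auto
  finally show "A *\<^sub>v col U i = complex_of_real (d i) \<cdot>\<^sub>v col U i" .
  have "col U i \<bullet>c col U i = (mat_adjoint U * U) $$ (i, i)"
    using U(1) i by (auto simp: scalar_prod_def mult.commute intro!: sum.cong)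
  then show "col U i \<bullet>c col U i = 1" unfolding U(3) using i by simp
qed

lemma spectral_decomp_form:
  assumes "spectral_decomp n A U d" "v \<in> carrier_vec n"
  shows "(A *\<^sub>v v) \<bullet>c v = complex_of_real (\<Sum>i<n. d i * (cmod ((mat_adjoint U *\<^sub>v v) $ i))\<^sup>2)"
proof -
  note U = spectral_decompD[OF assms(1)]
  define w where "w = mat_adjoint U *\<^sub>v v"
  define D where "D = diagonal n (\<lambda>i. complex_of_real (d i))"
  have w: "w \<in> carrier_vec n" using U assms(2) by (simp add: w_def)
  have D: "D \<in> carrier_mat n n" by (simp add: D_def)
  have "A *\<^sub>v v = U *\<^sub>v (D *\<^sub>v w)"
    using U(1,5) D assms(2) unfolding U(6) D_def[symmetric] w_def
    by (simp add: assoc_mult_mat_vec[of _ n n _ n])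
  then have "(A *\<^sub>v v) \<bullet>c v = (D *\<^sub>v w) \<bullet>c w"
    using cscalar_prod_mat_adjoint[of U n n "D *\<^sub>v w" v] U(1) D w assms(2) by (simp add: w_def)
  also have "\<dots> = (\<Sum>i<n. complex_of_real (d i * (cmod (w $ i))\<^sup>2))"
    using w D unfolding scalar_prod_def
    by (auto simp: D_def diagonal_mult_vec complex_norm_square lessThan_atLeast0
        simp del: of_real_power intro!: sum.cong)
  finally show ?thesis by (simp add: w_def)
qed

lemma unitary_norm:
  assumes "unitary_mat n U" "v \<in> carrier_vec n"
  shows "(\<Sum>i<n. (cmod ((U *\<^sub>v v) $ i))\<^sup>2) = (\<Sum>i<n. (cmod (v $ i))\<^sup>2)"
proof -
  note U = unitary_matD[OF assms(1)]
  have "(U *\<^sub>v v) \<bullet>c (U *\<^sub>v v) = v \<bullet>c ((mat_adjoint U * U) *\<^sub>v v)"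
    using U(1,4) assms(2) by (simp add: cscalar_prod_mat_adjoint[of U n n] assoc_mult_mat_vec[of _ n n _ n])
  then have "(U *\<^sub>v v) \<bullet>c (U *\<^sub>v v) = v \<bullet>c v"
    using U(2) assms(2) by simp
  then show ?thesis
    using U(1) assms(2) unfolding cscalar_prod_self of_real_eq_iff by simp
qed

lemma pos_semidef_hermitian: "pos_semidef A \<Longrightarrow> mat_adjoint A = A"
  by (simp add: pos_semidef_def hermitian_mat_def)

lemma hermitian_square:
  assumes "mat_adjoint A = A" "dim_row A = n"
  shows "A \<in> carrier_mat n n"
proof -
  have "dim_row A = dim_col A" using mat_adjoint_dim(1)[of A] unfolding assms(1) .
  then show ?thesis using assms(2) by (intro carrier_matI) simp_all
qed

lemma pos_semidef_form:
  "pos_semidef A \<Longrightarrow> A \<in> carrier_mat n n \<Longrightarrow> v \<in> carrier_vec n \<Longrightarrow> 0 \<le> (A *\<^sub>v v) \<bullet>c v"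
  by (auto simp: pos_semidef_def)

lemma pos_semidefI:
  assumes "A \<in> carrier_mat n n" "mat_adjoint A = A"
    and "\<And>v. v \<in> carrier_vec n \<Longrightarrow> 0 \<le> (A *\<^sub>v v) \<bullet>c v"
  shows "pos_semidef A"
  using assms by (auto simp: pos_semidef_def hermitian_mat_def)

lemma pos_semidef_add:
  assumes "pos_semidef A" "pos_semidef B" "A \<in> carrier_mat n n" "B \<in> carrier_mat n n"
  shows "pos_semidef (A + B)"
proof (rule pos_semidefI)
  show "mat_adjoint (A + B) = A + B"
    using assms by (simp add: mat_adjoint_add[of _ n n] pos_semidef_hermitian)
  fix v :: "complex vec" assume v: "v \<in> carrier_vec n"
  have "((A + B) *\<^sub>v v) \<bullet>c v = (A *\<^sub>v v) \<bullet>c v + (B *\<^sub>v v) \<bullet>c v"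
    using assms v by (simp add: add_mult_distrib_mat_vec[of _ n n] add_scalar_prod_distrib[of _ n])
  then show "0 \<le> ((A + B) *\<^sub>v v) \<bullet>c v"
    using assms v by (simp add: pos_semidef_form[of _ n])
qed (use assms in simp)

lemma pos_semidef_congruence:
  assumes "pos_semidef A" "A \<in> carrier_mat n n" "X \<in> carrier_mat n n"
  shows "pos_semidef (X * A * mat_adjoint X)"
proof (rule pos_semidefI)
  define Y where "Y = mat_adjoint X"
  have Y: "Y \<in> carrier_mat n n" "mat_adjoint Y = X" using assms by (auto simp: Y_def)
  show "mat_adjoint (X * A * mat_adjoint X) = X * A * mat_adjoint X"
    using assms Y unfolding Y_def[symmetric]
    by (simp add: mat_adjoint_mult[of _ n n _ n] pos_semidef_hermitian
        assoc_mult_mat[of _ n n _ n _ n]) (simp add: Y_def)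
  fix v :: "complex vec" assume v: "v \<in> carrier_vec n"
  have "(X * A * Y *\<^sub>v v) \<bullet>c v = (X *\<^sub>v (A *\<^sub>v (Y *\<^sub>v v))) \<bullet>c v"
    using assms Y v by (simp add: assoc_mult_mat_vec[of _ n n _ n] assoc_mult_mat[of _ n n _ n _ n])
  also have "\<dots> = (A *\<^sub>v (Y *\<^sub>v v)) \<bullet>c (Y *\<^sub>v v)"
    unfolding Y_def using assms v by (subst cscalar_prod_mat_adjoint[of X n n]) auto
  also have "0 \<le> \<dots>"
    using assms Y v by (simp add: pos_semidef_form[of _ n])
  finally show "0 \<le> (X * A * mat_adjoint X *\<^sub>v v) \<bullet>c v" by (simp add: Y_def)
qed (use assms in simp)

lemma spectral_decomp_pos_semidef_iff:
  assumes A: "spectral_decomp n A U d"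
  shows "pos_semidef A \<longleftrightarrow> (\<forall>i<n. 0 \<le> d i)"
proof
  assume psd: "pos_semidef A"
  show "\<forall>i<n. 0 \<le> d i"
  proof (intro allI impI)
    fix i assume i: "i < n"
    note U = spectral_decompD[OF A] and ev = spectral_decomp_eigenvector[OF A i]
    have u: "col U i \<in> carrier_vec n" using U i by simp
    then have "(A *\<^sub>v col U i) \<bullet>c col U i = complex_of_real (d i)"
      by (simp add: ev smult_scalar_prod_distrib[of _ n])
    then show "0 \<le> d i"
      using pos_semidef_form[OF psd U(2) u] by (simp add: less_eq_complex_def)
  qed
next
  note U = spectral_decompD[OF A]
  assume d: "\<forall>i<n. 0 \<le> d i"
  show "pos_semidef A"
  proof (rule pos_semidefI[OF U(2)])
    define D where "D = diagonal n (\<lambda>i. complex_of_real (d i))"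
    have D: "D \<in> carrier_mat n n" "mat_adjoint D = D"
      by (simp_all add: D_def) (intro eq_matI; auto simp: diagonal_def)
    define Y where "Y = mat_adjoint U"
    have Y: "Y \<in> carrier_mat n n" "mat_adjoint Y = U" using U by (auto simp: Y_def)
    show "mat_adjoint A = A"
      using U(1) D Y unfolding U(6) D_def[symmetric] Y_def[symmetric]
      by (simp add: mat_adjoint_mult[of _ n n _ n] assoc_mult_mat[of _ n n _ n _ n]) (simp add: Y_def)
    show "0 \<le> (A *\<^sub>v v) \<bullet>c v" if "v \<in> carrier_vec n" for v
    proof -
      have "0 \<le> (\<Sum>i<n. d i * (cmod ((mat_adjoint U *\<^sub>v v) $ i))\<^sup>2)"
        using d by (intro sum_nonneg) simp
      then show ?thesis unfolding spectral_decomp_form[OF A that] by (simp add: less_eq_complex_def)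
    qed
  qed
qed

section \<open>Square roots and inverses\<close>

lemma unitary_conjugate_mult:
  assumes "unitary_mat n U"
  shows "(U * diagonal n d * mat_adjoint U) * (U * diagonal n e * mat_adjoint U)
    = U * diagonal n (\<lambda>i. d i * e i) * mat_adjoint U"
proof -
  note U = unitary_matD[OF assms]
  define D E V where "D = diagonal n d" and "E = diagonal n e" and "V = mat_adjoint U"
  have c: "D \<in> carrier_mat n n" "E \<in> carrier_mat n n" "V \<in> carrier_mat n n"
    using U by (simp_all add: D_def E_def V_def)
  have "(U * D * V) * (U * E * V) = U * D * (V * U) * (E * V)"
    using U(1) c by (simp add: assoc_mult_mat[of _ n n _ n _ n])
  also have "V * U = 1\<^sub>m n" using U(2) by (simp add: V_def)
  also have "U * D * 1\<^sub>m n * (E * V) = U * (D * E) * V"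
    using U(1) c by (simp add: assoc_mult_mat[of _ n n _ n _ n])
  finally show ?thesis by (simp add: D_def E_def V_def diagonal_mult)
qed

lemma pos_semidef_sqrt_exists:
  assumes psd: "pos_semidef A" and A: "A \<in> carrier_mat n n"
  shows "\<exists>X. pos_semidef X \<and> X * X = A"
proof -
  obtain U d where dec: "spectral_decomp n A U d"
    using spectral_decomp_exists[OF A] psd by (auto simp: pos_semidef_def)
  have d: "0 \<le> d i" if "i < n" for i using dec psd that by (simp add: spectral_decomp_pos_semidef_iff)
  define X where "X = U * diagonal n (\<lambda>i. complex_of_real (sqrt (d i))) * mat_adjoint U"
  have "spectral_decomp n X U (\<lambda>i. sqrt (d i))"
    using dec by (simp add: spectral_decomp_def X_def)
  then have "pos_semidef X" using d by (simp add: spectral_decomp_pos_semidef_iff)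
  moreover have "diagonal n (\<lambda>i. complex_of_real (sqrt (d i)) * complex_of_real (sqrt (d i)))
      = diagonal n (\<lambda>i. complex_of_real (d i))"
    using d by (intro eq_matI) (auto simp: diagonal_def simp flip: of_real_mult)
  then have "X * X = A"
    using dec unfolding X_def by (simp add: spectral_decomp_def unitary_conjugate_mult)
  ultimately show ?thesis by blast
qed

text \<open>Let \<open>u\<close> be a unit eigenvector of \<open>E = X - Y\<close> with eigenvalue \<open>d\<close>. From \<open>X * E + E * Y = 0\<close>
  it follows that \<open>d * (a + b) = 0\<close>, where \<open>a\<close> and \<open>b\<close> are the values of the forms of \<open>X\<close> and \<open>Y\<close>
  at \<open>u\<close>. As \<open>a\<close> and \<open>b\<close> are non-negative and \<open>a - b = d\<close>, the eigenvalue \<open>d\<close> is zero. A Hermitian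
  matrix all of whose eigenvalues are zero vanishes.\<close>

lemma pos_semidef_sqrt_unique:
  assumes psd: "pos_semidef X" "pos_semidef Y"
    and c: "X \<in> carrier_mat n n" "Y \<in> carrier_mat n n"
    and sq: "X * X = Y * Y"
  shows "X = Y"
proof -
  define E where "E = X - Y"
  have E: "E \<in> carrier_mat n n" using c by (simp add: E_def minus_carrier_mat)
  have herm_E: "mat_adjoint E = E"
    using c psd by (simp add: E_def mat_adjoint_minus[of _ n n] pos_semidef_hermitian)
  then obtain U d where dec: "spectral_decomp n E U d"
    using spectral_decomp_exists[OF E] by (auto simp: hermitian_mat_def)
  note U = spectral_decompD[OF dec]
  have d0: "d i = 0" if i: "i < n" for i
  proof -
    define u where "u = col U i"
    have u: "u \<in> carrier_vec n" using U i by (simp add: u_def)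
    have Eu: "E *\<^sub>v u = complex_of_real (d i) \<cdot>\<^sub>v u" and uu: "u \<bullet>c u = 1"
      using spectral_decomp_eigenvector[OF dec i] by (simp_all add: u_def)
    define a b p where "a = (X *\<^sub>v u) \<bullet>c u" and "b = (Y *\<^sub>v u) \<bullet>c u"
      and "p = (X *\<^sub>v (Y *\<^sub>v u)) \<bullet>c u"
    have E_vec: "E *\<^sub>v w = X *\<^sub>v w - Y *\<^sub>v w" if "w \<in> carrier_vec n" for w
      using c that unfolding E_def by (simp add: minus_mult_distrib_mat_vec[of _ n n])
    have E_form: "(E *\<^sub>v w) \<bullet>c u = (X *\<^sub>v w) \<bullet>c u - (Y *\<^sub>v w) \<bullet>c u"
      if "w \<in> carrier_vec n" for w
      using c that u by (simp add: E_vec minus_scalar_prod_distrib[of _ n])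
    have E_swap: "(E *\<^sub>v w) \<bullet>c u = complex_of_real (d i) * (w \<bullet>c u)"
      if "w \<in> carrier_vec n" for w
      using cscalar_prod_mat_adjoint[OF E that u] that u
      by (simp add: herm_E Eu conjugate_smult_vec scalar_prod_smult_distrib[of _ n])
    \<comment> \<open>The products \<open>X * E\<close> and \<open>E * Y\<close> are evaluated at \<open>u\<close> in two ways, by expanding \<open>E\<close> and by
       letting it act on its eigenvector; \<open>p\<close> and \<open>q\<close> are the values of \<open>X * Y\<close> and of the common
       square.\<close>
    define q where "q = (Y *\<^sub>v (Y *\<^sub>v u)) \<bullet>c u"
    have XX: "(X *\<^sub>v (X *\<^sub>v u)) \<bullet>c u = q"
      unfolding q_def using c u sq by (metis assoc_mult_mat_vec)
    have "complex_of_real (d i) * a = (X *\<^sub>v (E *\<^sub>v u)) \<bullet>c u"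
      using c u by (simp add: Eu a_def mult_mat_vec[of _ n n] smult_scalar_prod_distrib[of _ n])
    also have "\<dots> = q - p"
      using c u by (simp add: E_vec p_def XX mult_minus_distrib_mat_vec[of _ n n] minus_scalar_prod_distrib[of _ n])
    finally have da: "complex_of_real (d i) * a = q - p" .
    have db: "complex_of_real (d i) * b = p - q"
      using E_form[of "Y *\<^sub>v u"] E_swap[of "Y *\<^sub>v u"] c u by (simp add: p_def q_def b_def)
    have "complex_of_real (d i) * (a + b) = 0" by (simp add: distrib_left da db)
    moreover have "a - b = complex_of_real (d i)"
      using E_form[OF u] E_swap[OF u] uu by (simp add: a_def b_def)
    moreover have "0 \<le> a" "0 \<le> b"
      using pos_semidef_form[of _ n u] psd c u by (simp_all add: a_def b_def)
    ultimately show "d i = 0" by (auto simp: less_eq_complex_def complex_eq_iff)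
  qed
  then have "diagonal n (\<lambda>i. complex_of_real (d i)) = 0\<^sub>m n n"
    by (intro eq_matI) (auto simp: diagonal_def)
  then have "E = 0\<^sub>m n n" using U(1,5,6) by simp
  show ?thesis
  proof (rule eq_matI)
    fix i j assume ij: "i < dim_row Y" "j < dim_col Y"
    then have "E $$ (i, j) = 0" using c unfolding \<open>E = 0\<^sub>m n n\<close> by simp
    then show "X $$ (i, j) = Y $$ (i, j)" using ij c by (simp add: E_def)
  qed (use c in auto)
qed

text \<open>The definite description ranges over matrices of every size; a Hermitian candidate is square, and
  then its square determines its size.\<close>

lemma mat_sqrt_eqI:
  assumes "pos_semidef X" "X \<in> carrier_mat n n" "X * X = A"
  shows "mat_sqrt A = X"
  unfolding mat_sqrt_def
proof (rule the_equality)
  fix Y assume Y: "pos_semidef Y \<and> Y * Y = A"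
  then have "dim_row Y = dim_row X"
    using assms(3) by (metis index_mult_mat(2))
  then have "Y \<in> carrier_mat n n"
    using Y assms(2) by (intro hermitian_square pos_semidef_hermitian) simp_all
  then show "Y = X" using pos_semidef_sqrt_unique[of Y X n] Y assms by simp
qed (use assms in simp)

lemma mat_sqrt_correct:
  assumes "pos_semidef A" "A \<in> carrier_mat n n"
  shows "pos_semidef (mat_sqrt A)" "mat_sqrt A \<in> carrier_mat n n" "mat_sqrt A * mat_sqrt A = A"
proof -
  obtain X where X: "pos_semidef X" "X * X = A" using pos_semidef_sqrt_exists[OF assms] by blast
  then have "dim_row X = n" using assms(2) by (metis carrier_matD(1) index_mult_mat(2))
  then have c: "X \<in> carrier_mat n n"
    by (intro hermitian_square pos_semidef_hermitian X(1))
  have "mat_sqrt A = X" using X c by (intro mat_sqrt_eqI)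
  with X c show "pos_semidef (mat_sqrt A)" "mat_sqrt A \<in> carrier_mat n n"
    "mat_sqrt A * mat_sqrt A = A" by auto
qed

lemma mat_inv_correct:
  assumes A: "A \<in> carrier_mat n n" and det: "det A \<noteq> 0"
  shows "mat_inv A \<in> carrier_mat n n" "A * mat_inv A = 1\<^sub>m n" "mat_inv A * A = 1\<^sub>m n"
proof -
  have "mat_inverse A \<noteq> None"
    using mat_inverse(1)[OF A, of "()"] det_non_zero_imp_unit[OF A det, of "()"] by blast
  then obtain B where "mat_inverse A = Some B" by blast
  with mat_inverse(2)[OF A this]
  show "mat_inv A \<in> carrier_mat n n" "A * mat_inv A = 1\<^sub>m n" "mat_inv A * A = 1\<^sub>m n"
    by (auto simp: mat_inv_def)
qed

lemma mat_cancel_left: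
  fixes X :: "'a :: comm_ring_1 mat"
  assumes "S * R = 1\<^sub>m n" "S \<in> carrier_mat n n" "R \<in> carrier_mat n n" "X \<in> carrier_mat n n"
  shows "S * (R * X) = X"
  using assms(1,4) assoc_mult_mat[OF assms(2-4)] by simp

lemma mat_inverse_unique:
  fixes A :: "'a :: comm_ring_1 mat"
  assumes "B * A = 1\<^sub>m n" "A * C = 1\<^sub>m n"
    "A \<in> carrier_mat n n" "B \<in> carrier_mat n n" "C \<in> carrier_mat n n"
  shows "B = C"
  using mat_cancel_left[OF assms(1,4,3,5)] assms(2,4) by simp

lemma mat_inv_hermitian:
  assumes A: "A \<in> carrier_mat n n" "det A \<noteq> 0" "mat_adjoint A = A"
  shows "mat_adjoint (mat_inv A) = mat_inv A"
proof (rule mat_inverse_unique)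
  note inv = mat_inv_correct[OF A(1,2)]
  show "A * mat_inv A = 1\<^sub>m n" by (fact inv)
  show "mat_adjoint (mat_inv A) * A = 1\<^sub>m n"
    using mat_adjoint_mult[OF A(1) inv(1)] A(3) inv(2) by simp
qed (use A mat_inv_correct[OF A(1,2)] in simp_all)

lemma pos_def_imp_pos_semidef:
  assumes "pos_def A"
  shows "pos_semidef A"
  unfolding pos_semidef_def
proof (intro conjI ballI)
  show "hermitian_mat A" using assms by (simp add: pos_def_def)
  have "mat_adjoint A = A" using assms unfolding pos_def_def hermitian_mat_def by (rule conjunct1)
  note sq = hermitian_square[OF this refl]
  fix v :: "complex vec" assume v: "v \<in> carrier_vec (dim_row A)"
  show "0 \<le> (A *\<^sub>v v) \<bullet>c v"
  proof (cases "v = 0\<^sub>v (dim_row A)")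
    case True
    have "(A *\<^sub>v v) \<bullet>c v = 0"
      unfolding True conjugate_zero_vec
      by (rule scalar_prod_right_zero[OF mult_mat_vec_carrier[OF sq zero_carrier_vec]])
    then show ?thesis by (simp only: order_refl)
  next
    case False
    then show ?thesis using assms v by (simp add: pos_def_def order.strict_implies_order)
  qed
qed

lemma pos_def_det:
  assumes "pos_def A" "A \<in> carrier_mat n n"
  shows "det A \<noteq> 0"
proof
  assume "det A = 0"
  then obtain v where v: "v \<in> carrier_vec n" "v \<noteq> 0\<^sub>v n" "A *\<^sub>v v = 0\<^sub>v n"
    using det_0_iff_vec_prod_zero[OF assms(2)] by blast
  moreover have "0 < (A *\<^sub>v v) \<bullet>c v"
    using assms v(1,2) by (auto simp: pos_def_def)
  ultimately show False by simp
qed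

lemma pos_semidef_gram:
  assumes "X \<in> carrier_mat n n"
  shows "pos_semidef (mat_adjoint X * X)"
proof (rule pos_semidefI)
  show "mat_adjoint (mat_adjoint X * X) = mat_adjoint X * X"
    using assms by (simp add: mat_adjoint_mult[of _ n n _ n])
  fix v :: "complex vec" assume v: "v \<in> carrier_vec n"
  have "((mat_adjoint X * X) *\<^sub>v v) \<bullet>c v = (mat_adjoint X *\<^sub>v (X *\<^sub>v v)) \<bullet>c v"
    using assms v by (simp add: assoc_mult_mat_vec[of _ n n _ n])
  also have "\<dots> = (X *\<^sub>v v) \<bullet>c (X *\<^sub>v v)"
    using cscalar_prod_mat_adjoint[of "mat_adjoint X" n n "X *\<^sub>v v" v] assms v by simp
  finally show "0 \<le> ((mat_adjoint X * X) *\<^sub>v v) \<bullet>c v" by (simp add: conjugate_square_ge_0_vec)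
qed (use assms in simp)

section \<open>Singular values of positive semi-definite matrices and their monotonicity\<close>

lemma diag_mat_diagonal: "diag_mat (diagonal n d) = map d [0..<n]"
  by (auto simp: diag_mat_def diagonal_def)

lemma proots_prod_linear: "proots (\<Prod>a\<leftarrow>as. [:- a, 1:]) = mset (as :: 'a :: idom list)"
proof (induction as)
  case (Cons a as)
  have "(\<Prod>a\<leftarrow>as. [:- a, 1:]) \<noteq> 0" by (auto simp: prod_list_zero_iff)
  then show ?case using Cons by (simp add: proots_mult del: mult_pCons_left)
qed simp

text \<open>The matrix is its own adjoint, so the eigenvalues under the square root are the squares of its
  own eigenvalues, and these are non-negative.\<close>

lemma singular_value_pos_semidef:
  assumes dec: "spectral_decomp n A U d" and psd: "pos_semidef A" and j: "j \<in> {1..n}"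
  shows "singular_value j A = d (j - 1)"
proof -
  note U = spectral_decompD[OF dec]
  have d: "0 \<le> d i" if "i < n" for i using dec psd that by (simp add: spectral_decomp_pos_semidef_iff)
  define s where "s i = complex_of_real (d i) * complex_of_real (d i)" for i
  have "A * A = U * diagonal n s * mat_adjoint U"
    using dec unitary_conjugate_mult[of n U] unfolding s_def by (simp add: spectral_decomp_def)
  then have AA: "mat_adjoint A * A = U * diagonal n s * mat_adjoint U"
    using psd by (simp add: pos_semidef_hermitian)
  have "mat_adjoint A * A \<in> carrier_mat n n" using U(2) by simp
  from similar_mat_witI[OF U(4,3) AA this diagonal_carrier U(1,5)]
  have "similar_mat (mat_adjoint A * A) (diagonal n s)"
    by (auto simp: similar_mat_def)
  then have "char_poly (mat_adjoint A * A) = char_poly (diagonal n s)"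
    by (rule char_poly_similar)
  also have "\<dots> = (\<Prod>a\<leftarrow>map s [0..<n]. [:- a, 1:])"
    using char_poly_upper_triangular[OF diagonal_carrier[of n s]]
    unfolding diag_mat_diagonal by (simp add: upper_triangular_def diagonal_def del: map_map)
  finally have "image_mset (\<lambda>e. sqrt (Re e)) (proots (char_poly (mat_adjoint A * A)))
      = mset (map (\<lambda>e. sqrt (Re e)) (map s [0..<n]))"
    by (simp only: proots_prod_linear mset_map)
  also have "map (\<lambda>e. sqrt (Re e)) (map s [0..<n]) = map d [0..<n]"
    using d by (simp add: s_def)
  finally have "singular_values A = rev (sort (map d [0..<n]))"
    by (simp only: singular_values_def sorted_list_of_multiset_mset)
  also have "sort (map d [0..<n]) = rev (map d [0..<n])"
    using U(7) by (intro properties_for_sort) (auto simp: sorted_iff_nth_mono rev_nth)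
  finally have "singular_values A = map d [0..<n]" by simp
  moreover have "j - 1 < n" using j by auto
  ultimately show ?thesis by (simp add: singular_value_def)
qed

text \<open>Weyl's monotonicity principle, by the dimension count behind the min-max theorem. Some non-zero
  vector \<open>v\<close> is both a combination of the eigenvectors \<open>0, ..., j\<close> of \<open>H\<close> and orthogonal to the
  eigenvectors \<open>0, ..., j - 1\<close> of \<open>K\<close>: there are \<open>j + 1\<close> unknowns and \<open>j\<close> equations. On \<open>v\<close> the form
  of \<open>H\<close> is at least \<open>d j\<close> times the squared norm, and that of \<open>K\<close> is at most \<open>e j\<close> times it.\<close>

lemma spectral_decomp_mono:
  assumes H: "spectral_decomp n H U d" and K: "spectral_decomp n K W e"
    and le: "\<And>v. v \<in> carrier_vec n \<Longrightarrow> (H *\<^sub>v v) \<bullet>c v \<le> (K *\<^sub>v v) \<bullet>c v"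
    and j: "j < n"
  shows "d j \<le> e j"
proof -
  note U = spectral_decompD[OF H] and W = spectral_decompD[OF K]
  define T where "T = mat_adjoint W * U"
  have T: "T \<in> carrier_mat n n" using U W by (simp add: T_def)
  \<comment> \<open>A square system for the coordinates of \<open>v\<close> in the eigenbasis of \<open>H\<close>: the equations before
     \<open>j\<close> express orthogonality to eigenvectors of \<open>K\<close>, those after \<open>j\<close> make a coordinate vanish,
     and equation \<open>j\<close> is vacuous, which makes the determinant zero.\<close>
  define rows where "rows r = (if r < j then row T r else unit_vec n r)" for r
  have rows: "rows \<in> {0..<n} \<rightarrow> carrier_vec n" using T by (auto simp: rows_def)
  define M where "M = mat\<^sub>r n n (\<lambda>r. if r = j then 0\<^sub>v n else rows r)"
  have M: "M \<in> carrier_mat n n" by (simp add: M_def)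
  have "det M = 0" unfolding M_def using det_row_0[OF j rows] .
  then obtain a where a: "a \<in> carrier_vec n" "a \<noteq> 0\<^sub>v n" and Ma: "M *\<^sub>v a = 0\<^sub>v n"
    using det_0_iff_vec_prod_zero[OF M] by blast
  have rows_a: "rows r \<bullet> a = 0" if "r < n" "r \<noteq> j" for r
  proof -
    have "row M r = rows r" using that rows by (simp add: M_def Pi_iff)
    then show ?thesis using arg_cong[OF Ma, of "\<lambda>x. x $ r"] M that by simp
  qed
  have a_high: "a $ r = 0" if "r < n" "j < r" for r
    using rows_a[of r] that a by (simp add: rows_def)
  define v where "v = U *\<^sub>v a"
  have v: "v \<in> carrier_vec n" using U a by (simp add: v_def)
  have Uv: "mat_adjoint U *\<^sub>v v = a"
  proof -
    have "mat_adjoint U *\<^sub>v v = (mat_adjoint U * U) *\<^sub>v a"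
      using U(1,5) a(1) by (simp add: v_def assoc_mult_mat_vec[of _ n n _ n])
    then show ?thesis unfolding U(3) using a(1) by simp
  qed
  define b where "b = mat_adjoint W *\<^sub>v v"
  have "b = T *\<^sub>v a"
    using U W a by (simp add: b_def T_def v_def assoc_mult_mat_vec[of _ n n _ n])
  then have b_low: "b $ r = 0" if "r < j" for r
    using rows_a[of r] that j T by (simp add: rows_def)
  have norm_W: "(\<Sum>i<n. (cmod (b $ i))\<^sup>2) = (\<Sum>i<n. (cmod (a $ i))\<^sup>2)"
  proof -
    have "unitary_mat n (mat_adjoint W)" using W by (simp add: unitary_mat_def)
    moreover have "unitary_mat n U" using H by (simp add: spectral_decomp_def)
    ultimately show ?thesis using v a by (simp add: b_def v_def unitary_norm)
  qed
  have "d j * (\<Sum>i<n. (cmod (a $ i))\<^sup>2) \<le> (\<Sum>i<n. d i * (cmod (a $ i))\<^sup>2)"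
    unfolding sum_distrib_left
  proof (rule sum_mono)
    fix i assume "i \<in> {..<n}"
    then show "d j * (cmod (a $ i))\<^sup>2 \<le> d i * (cmod (a $ i))\<^sup>2"
      using U(7)[of i j] j a_high[of i] by (cases "i \<le> j") (auto intro: mult_right_mono)
  qed
  also have "\<dots> \<le> (\<Sum>i<n. e i * (cmod (b $ i))\<^sup>2)"
    using le[OF v] unfolding spectral_decomp_form[OF H v] spectral_decomp_form[OF K v] Uv b_def
    by (simp add: less_eq_complex_def)
  also have "\<dots> \<le> e j * (\<Sum>i<n. (cmod (b $ i))\<^sup>2)"
    unfolding sum_distrib_left
  proof (rule sum_mono)
    fix i assume "i \<in> {..<n}"
    then show "e i * (cmod (b $ i))\<^sup>2 \<le> e j * (cmod (b $ i))\<^sup>2"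
      using W(7)[of j i] b_low[of i] by (cases "j \<le> i") (auto intro: mult_right_mono)
  qed
  finally have "d j * (\<Sum>i<n. (cmod (a $ i))\<^sup>2) \<le> e j * (\<Sum>i<n. (cmod (a $ i))\<^sup>2)"
    unfolding norm_W .
  moreover have "(\<Sum>i<n. (cmod (a $ i))\<^sup>2) > 0"
  proof -
    obtain i where "i < n" "a $ i \<noteq> 0" using a by (metis carrier_vecD eq_vecI index_zero_vec)
    then show ?thesis by (intro sum_pos2[of _ i]) auto
  qed
  ultimately show ?thesis by simp
qed

section \<open>The two means\<close>

text \<open>With \<open>Z = A^(-1/2) * B^(1/2)\<close>, the inner square roots of the two means are the absolute values of
  the adjoint of \<open>Z\<close> and of \<open>Z\<close>. If \<open>R\<close> denotes the absolute value of \<open>Z\<close>, the polar decomposition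
  gives \<open>Z * R^(-1) * Z^*\<close> for that of the adjoint: it is positive semi-definite, and its square is
  \<open>Z * Z^*\<close>. Multiplying by \<open>A^(1/2)\<close> on both sides turns it into \<open>B^(1/2) * R^(-1) * B^(1/2)\<close>.\<close>

lemma means_eq:
  assumes "A \<in> carrier_mat n n" "B \<in> carrier_mat n n" "pos_def A" "pos_def B"
  defines "P \<equiv> mat_sqrt A" and "Q \<equiv> mat_sqrt B"
  obtains R S where "R \<in> carrier_mat n n" "S \<in> carrier_mat n n" "pos_semidef R"
    "mat_adjoint S = S" "R * S = 1\<^sub>m n" "S * R = 1\<^sub>m n"
    "A \<sharp> B = Q * S * Q" "A \<natural>\<natural> B = P * R * P"
proof -
  note psd = assms(3,4)[THEN pos_def_imp_pos_semidef]
  note sqrtA = mat_sqrt_correct[OF psd(1) assms(1), folded P_def]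
  note sqrtB = mat_sqrt_correct[OF psd(2) assms(2), folded Q_def]
  have herm: "mat_adjoint P = P" "mat_adjoint Q = Q"
    using sqrtA sqrtB by (simp_all add: pos_semidef_hermitian)
  have "det P * det P \<noteq> 0" "det Q * det Q \<noteq> 0"
    using pos_def_det[OF assms(3,1)] pos_def_det[OF assms(4,2)] sqrtA sqrtB
    by (simp_all flip: det_mult[of _ n])
  then have det: "det P \<noteq> 0" "det Q \<noteq> 0" by auto
  define N where "N = mat_inv P"
  note N = mat_inv_correct[OF sqrtA(2) det(1), folded N_def]
  have herm_N: "mat_adjoint N = N"
    using mat_inv_hermitian[OF sqrtA(2) det(1) herm(1)] by (simp add: N_def)
  have inv_A: "mat_inv A = N * N"
  proof (rule mat_inverse_unique)
    show "mat_inv A * A = 1\<^sub>m n" using mat_inv_correct[OF assms(1) pos_def_det[OF assms(3,1)]] by simp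
    have "A * (N * N) = P * (P * (N * N))"
      using N sqrtA(2) unfolding sqrtA(3)[symmetric] by (simp add: assoc_mult_mat[of _ n n _ n _ n])
    then show "A * (N * N) = 1\<^sub>m n"
      using N sqrtA(2) by (simp add: mat_cancel_left[of P N n])
  qed (use assms N mat_inv_correct[OF assms(1) pos_def_det[OF assms(3,1)]] in simp_all)
  define Z where "Z = N * Q"
  define Y where "Y = Q * N"
  have Z: "Z \<in> carrier_mat n n" "Y \<in> carrier_mat n n" "mat_adjoint Z = Y" "mat_adjoint Y = Z"
    using N sqrtB herm herm_N by (auto simp: Z_def Y_def mat_adjoint_mult[of _ n n _ n])
  define R where "R = mat_sqrt (Y * Z)"
  have "pos_semidef (Y * Z)" using pos_semidef_gram[OF Z(1)] Z by simp
  note R = mat_sqrt_correct[OF this, of n, folded R_def]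
  have Rc: "R \<in> carrier_mat n n" using R Z by simp
  have RR: "R * R = Y * Z" using R(3) Z by simp
  have "det P * det N = 1"
    using det_mult[OF sqrtA(2) N(1)] N by simp
  then have "det N \<noteq> 0" by auto
  have "det R * det R = det (R * R)" using det_mult[OF Rc Rc] by simp
  also have "\<dots> = det Q * det N * (det N * det Q)"
    unfolding RR Y_def Z_def using N sqrtB by (simp add: det_mult[of _ n])
  finally have det_R: "det R \<noteq> 0" using det \<open>det N \<noteq> 0\<close> by auto
  define S where "S = mat_inv R"
  note S = mat_inv_correct[OF Rc det_R, folded S_def]
  have psd_R: "pos_semidef R" using R Z by simp
  have herm_S: "mat_adjoint S = S"
    using mat_inv_hermitian[OF Rc det_R pos_semidef_hermitian[OF psd_R]] by (simp add: S_def)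
  \<comment> \<open>\<open>X\<close> is the absolute value of the adjoint \<open>Y\<close> of \<open>Z\<close>.\<close>
  define X where "X = Z * (S * Y)"
  have X: "X \<in> carrier_mat n n" using Z S by (simp add: X_def)
  have "X = (Z * S) * R * mat_adjoint (Z * S)"
    using Z S Rc herm_S
    by (simp add: X_def mat_adjoint_mult[of _ n n _ n] assoc_mult_mat[of _ n n _ n _ n] mat_cancel_left[of S R n])
  then have psd_X: "pos_semidef X"
    using pos_semidef_congruence[OF psd_R Rc, of "Z * S"] Z S by simp
  have "X * X = Z * (S * ((Y * Z) * (S * Y)))"
    using Z S by (simp add: X_def assoc_mult_mat[of _ n n _ n _ n])
  also have "\<dots> = Z * Y"
    unfolding RR[symmetric] using Z S Rc
    by (simp add: assoc_mult_mat[of _ n n _ n _ n] mat_cancel_left[of S R n] mat_cancel_left[of R S n])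
  also have "\<dots> = N * B * N"
    unfolding Z_def Y_def sqrtB(3)[symmetric] using N sqrtB(2) by (simp add: assoc_mult_mat[of _ n n _ n _ n])
  finally have sqrt_eq: "mat_sqrt (N * B * N) = X"
    using psd_X X by (intro mat_sqrt_eqI)
  have "A \<sharp> B = P * X * P"
    unfolding geometric_mean_def P_def[symmetric] N_def[symmetric] sqrt_eq ..
  also have "\<dots> = Q * S * Q"
    unfolding X_def Z_def Y_def using N S(1) sqrtA(2) sqrtB(2)
    by (simp add: assoc_mult_mat[of _ n n _ n _ n] mat_cancel_left[of P N n])
  finally have sharp: "A \<sharp> B = Q * S * Q" .
  have "Q * mat_inv A * Q = Y * Z"
    unfolding inv_A Y_def Z_def using N sqrtB(2) by (simp add: assoc_mult_mat[of _ n n _ n _ n])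
  then have "A \<natural>\<natural> B = P * R * P"
    unfolding natural_mean_def P_def[symmetric] Q_def[symmetric] R_def by simp
  with sharp show ?thesis using that[OF Rc S(1) psd_R herm_S S(2,3)] by blast
qed

text \<open>Completing the square. When \<open>S\<close> is Hermitian, and so are \<open>P\<close> and \<open>Q\<close>, the third summand on the
  left is a congruence transform of \<open>R\<close>; so if \<open>R\<close> is positive semi-definite, the identity bounds the
  mixed products by the right-hand side in the Loewner order.\<close>

lemma cross_terms_identity:
  fixes P Q R S :: "complex mat"
  assumes c: "P \<in> carrier_mat n n" "Q \<in> carrier_mat n n" "R \<in> carrier_mat n n" "S \<in> carrier_mat n n"
    and inv: "R * S = 1\<^sub>m n" "S * R = 1\<^sub>m n"
  shows "P * Q + Q * P + (P - Q * S) * R * (P - S * Q) = Q * S * Q + P * R * P"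
proof -
  have 1: "(P - Q * S) * R = P * R - Q"
    using c inv by (simp add: minus_mult_distrib_mat[of _ n n] assoc_mult_mat[of _ n n _ n _ n])
  have 2: "(P * R - Q) * (P - S * Q) = (P * R * P - Q * P) - (P * Q - Q * S * Q)"
    using c inv
    by (simp add: minus_mult_distrib_mat[of _ n n _ _ n] mult_minus_distrib_mat[of _ n n _ n]
        minus_carrier_mat assoc_mult_mat[of _ n n _ n _ n] mat_cancel_left[of R S n])
  have 3: "U + V + ((W - V) - (U - X)) = X + W"
    if "U \<in> carrier_mat n n" "V \<in> carrier_mat n n" "W \<in> carrier_mat n n" "X \<in> carrier_mat n n"
    for U V W X :: "complex mat"
    using that by (intro eq_matI) auto
  show ?thesis unfolding 1 2 by (rule 3) (use c in simp_all)
qed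

section \<open>The singular value inequality\<close>

theorem theorem4p1:
  fixes A B C :: "complex mat" and n j :: nat
  assumes "A \<in> carrier_mat n n" and "B \<in> carrier_mat n n" and "C \<in> carrier_mat n n"
    and "pos_def A" and "pos_def B" and "pos_def C"
    and "C \<ge>\<^sub>L A + B"
    and "j \<in> {1..n}"
  shows "singular_value j (C + mat_sqrt A * mat_sqrt B + mat_sqrt B * mat_sqrt A)
           \<le> singular_value j (C + A \<sharp> B + A \<natural>\<natural> B)"
proof -
  define P Q where "P = mat_sqrt A" and "Q = mat_sqrt B"
  note psd = assms(4,5)[THEN pos_def_imp_pos_semidef]
  note P = mat_sqrt_correct[OF psd(1) assms(1), folded P_def]
  note Q = mat_sqrt_correct[OF psd(2) assms(2), folded Q_def]
  obtain R S where c: "R \<in> carrier_mat n n" "S \<in> carrier_mat n n" and R: "pos_semidef R"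
    and S: "mat_adjoint S = S" and inv: "R * S = 1\<^sub>m n" "S * R = 1\<^sub>m n"
    and sharp: "A \<sharp> B = Q * S * Q" and natural: "A \<natural>\<natural> B = P * R * P"
    using means_eq[OF assms(1,2,4,5)] unfolding P_def Q_def by blast
  define H where "H = C + P * Q + Q * P"
  define F where "F = P - Q * S"
  define G where "G = F * R * mat_adjoint F"
  have Fc: "F \<in> carrier_mat n n" using P Q c by (simp add: F_def minus_carrier_mat)
  have Gc: "G \<in> carrier_mat n n" using Fc c by (simp add: G_def)
  have Hc: "H \<in> carrier_mat n n" using P Q assms(3) by (simp add: H_def)
  have G: "pos_semidef G" unfolding G_def by (rule pos_semidef_congruence[OF R c(1) Fc])
  have "mat_adjoint F = P - S * Q"
    using P Q c S unfolding F_def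
    by (simp add: mat_adjoint_minus[of _ n n] mat_adjoint_mult[of _ n n _ n] pos_semidef_hermitian)
  then have "P * Q + Q * P + G = A \<sharp> B + A \<natural>\<natural> B"
    using cross_terms_identity[OF P(2) Q(2) c inv] by (simp add: G_def F_def sharp natural)
  moreover have "C + A \<sharp> B + A \<natural>\<natural> B = C + (A \<sharp> B + A \<natural>\<natural> B)"
    using assms(3) P(2) Q(2) c by (simp add: sharp natural assoc_add_mat[of _ n n])
  moreover have "H + G = C + (P * Q + Q * P + G)"
    using assms(3) P(2) Q(2) Gc by (simp add: H_def assoc_add_mat[of _ n n])
  ultimately have K: "C + A \<sharp> B + A \<natural>\<natural> B = H + G" by simp
  \<comment> \<open>Positivity of \<open>H\<close> is where \<open>C \<ge>\<^sub>L A + B\<close> enters: it makes the singular values of \<open>H\<close>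
     its eigenvalues.\<close>
  have "H = (C - (A + B)) + mat_adjoint (P + Q) * (P + Q)"
  proof -
    have "mat_adjoint (P + Q) = P + Q"
      using P Q by (simp add: mat_adjoint_add[of _ n n] pos_semidef_hermitian)
    moreover have "(P + Q) * (P + Q) = (A + Q * P) + (P * Q + B)"
      using P Q by (simp add: add_mult_distrib_mat[of _ n n] mult_add_distrib_mat[of _ n n])
    moreover have "C + U + V = (C - (A + B)) + ((A + V) + (U + B))"
      if "U \<in> carrier_mat n n" "V \<in> carrier_mat n n" for U V :: "complex mat"
      using that assms(1-3) by (intro eq_matI) auto
    ultimately show ?thesis using P Q by (simp add: H_def)
  qed
  moreover have "pos_semidef (C - (A + B))" using assms(7) by (simp add: loewner_ge_def)
  moreover have "P + Q \<in> carrier_mat n n" using P Q by simp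
  ultimately have H: "pos_semidef H"
    using assms(1,2) pos_semidef_add[of "C - (A + B)" "mat_adjoint (P + Q) * (P + Q)" n]
      pos_semidef_gram[of "P + Q" n] by (simp add: minus_carrier_mat)
  have HG: "pos_semidef (H + G)" by (rule pos_semidef_add[OF H G Hc Gc])
  obtain U d where dec_H: "spectral_decomp n H U d"
    using spectral_decomp_exists[OF Hc] H by (auto simp: pos_semidef_def)
  obtain W e where dec_K: "spectral_decomp n (H + G) W e"
    using spectral_decomp_exists[of "H + G" n] HG Gc by (auto simp: pos_semidef_def)
  have "(H *\<^sub>v v) \<bullet>c v \<le> ((H + G) *\<^sub>v v) \<bullet>c v" if v: "v \<in> carrier_vec n" for v
    using pos_semidef_form[OF G Gc v] Hc Gc v
    by (simp add: add_mult_distrib_mat_vec[of _ n n] add_scalar_prod_distrib[of _ n])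
  then have "d (j - 1) \<le> e (j - 1)"
    using spectral_decomp_mono[OF dec_H dec_K] assms(8) by auto
  then have "singular_value j H \<le> singular_value j (H + G)"
    using singular_value_pos_semidef[OF dec_H H assms(8)]
      singular_value_pos_semidef[OF dec_K HG assms(8)] by simp
  then show ?thesis unfolding K by (simp add: H_def P_def Q_def)
qed

end
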